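(* Let $d\ge1$ and $I_1,\dots,I_d\ge1$ be integers, $L=I_1I_2\cdots I_d$, $1\le N<L$, and let $\mathcal{X}_{\cdot,1},\dots,\mathcal{X}_{\cdot,N}$ be tensors in $\mathbb{R}^{I_1\times\cdots\times I_d}$ spanning a subspace of dimension $r\ge1$. Let $a_{m,n}=\sum_{\mathbf{i}}\mathcal{X}_{\mathbf{i},m}\mathcal{X}_{\mathbf{i},n}$, $m,n=1,\dots,N$. Then the $N\times N$ matrix $(a_{m,n})$ is symmetric, nonnegative, and has rank $r$, so that it can be decomposed as $$a_{m,n}=\sum_{p=1}^{r}U_{m,p}\,\sigma_p^2\,U_{n,p}$$ with $\sigma_1,\dots,\sigma_r>0$ and $U$ an $N\times r$ matrix with orthonormal columns. For any such decomposition, put $b_{n,l}=U_{n,l}\,\sigma_l^{-1}$. Then the tensors $$\mathcal{Q}_{\mathbf{i},l}=\sum_{n=1}^{N}\mathcal{X}_{\mathbf{i},n}\,b_{n,l},\qquad l=1,\dots,r,$$ form an orthonormal basis of the subspace spanned by $\mathcal{X}_{\cdot,1},\dots,\mathcal{X}_{\cdot,N}$, and $$\mathcal{X}_{\mathbf{i},n}=\sum_{l=1}^{r}\mathcal{Q}_{\mathbf{i},l}\,U_{n,l}\,\sigma_l,\qquad n=1,\dots,N.$$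
   Context: An order-$d$ tensor in $\mathbb{R}^{I_1\times\cdots\times I_d}$ is a real array with entries indexed by multi-indices $\mathbf{i}=(i_1,\dots,i_d)$, $1\le i_k\le I_k$; $\mathcal{X}_{\mathbf{i},n}$ is the $\mathbf{i}$ entry of the $n$-th tensor $\mathcal{X}_{\cdot,n}$. The inner product is $\langle\mathcal{X},\mathcal{Y}\rangle=\sum_{\mathbf{i}}\mathcal{X}_{\mathbf{i}}\mathcal{Y}_{\mathbf{i}}$, and orthonormal means $\sum_{\mathbf{i}}\mathcal{Q}_{\mathbf{i},l}\mathcal{Q}_{\mathbf{i},l'}=\delta_{l,l'}$. "Nonnegative" means positive semidefinite. *)

theory Defs
  imports
    "HOL-Library.FuncSet"
    "HOL-Library.Function_Algebras"
    "Jordan_Normal_Form.DL_Rank"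
begin

(* The pointwise vector space structure on functions, so that the library's span, dim and
   independent apply to tensors. *)

instantiation "fun" :: (type, real_vector) real_vector
begin

definition scaleR_fun_def: "c *\<^sub>R f = (\<lambda>x. c *\<^sub>R f x)"

instance
  by standard (auto simp: scaleR_fun_def fun_eq_iff scaleR_add_right scaleR_add_left)

end

lemma scaleR_fun_apply [simp]: "(c *\<^sub>R f) x = c *\<^sub>R f x"
  by (simp add: scaleR_fun_def)

(* All indices start at 0: multi-indices of order d are families (i 0, ..., i (d - 1)) with
   i k < I k, extended by undefined. *)

type_synonym multi_index = "nat \<Rightarrow> nat"
type_synonym tensor = "multi_index \<Rightarrow> real"

definition multi_indices :: "nat \<Rightarrow> (nat \<Rightarrow> nat) \<Rightarrow> multi_index set" where
  "multi_indices d I = (\<Pi>\<^sub>E k\<in>{..<d}. {..<I k})"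

(* A real array indexed by multi_indices d I is encoded as a function vanishing off that set, so
   that equality and linear independence of such functions are those of the arrays. *)

definition tensors :: "nat \<Rightarrow> (nat \<Rightarrow> nat) \<Rightarrow> tensor set" where
  "tensors d I = {T. \<forall>i. i \<notin> multi_indices d I \<longrightarrow> T i = 0}"

definition tensor_inner :: "nat \<Rightarrow> (nat \<Rightarrow> nat) \<Rightarrow> tensor \<Rightarrow> tensor \<Rightarrow> real" where
  "tensor_inner d I S T = (\<Sum>i\<in>multi_indices d I. S i * T i)"

definition orthonormal_tensors ::
    "nat \<Rightarrow> (nat \<Rightarrow> nat) \<Rightarrow> nat \<Rightarrow> (nat \<Rightarrow> tensor) \<Rightarrow> bool" where
  "orthonormal_tensors d I r Q \<longleftrightarrow>
     (\<forall>l<r. \<forall>l'<r. tensor_inner d I (Q l) (Q l') = (if l = l' then 1 else 0))"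

definition orthonormal_tensor_basis ::
    "nat \<Rightarrow> (nat \<Rightarrow> nat) \<Rightarrow> nat \<Rightarrow> (nat \<Rightarrow> tensor) \<Rightarrow> tensor set \<Rightarrow> bool" where
  "orthonormal_tensor_basis d I r Q W \<longleftrightarrow>
     orthonormal_tensors d I r Q \<and>
     inj_on Q {..<r} \<and> independent (Q ` {..<r}) \<and> span (Q ` {..<r}) = W"

definition gram_matrix :: "nat \<Rightarrow> (nat \<Rightarrow> nat) \<Rightarrow> nat \<Rightarrow> (nat \<Rightarrow> tensor) \<Rightarrow> real mat" where
  "gram_matrix d I N X = mat N N (\<lambda>(m, n). tensor_inner d I (X m) (X n))"

definition positive_semidefinite :: "real mat \<Rightarrow> bool" where
  "positive_semidefinite A \<longleftrightarrow>
     (\<forall>v \<in> carrier_vec (dim_row A). 0 \<le> v \<bullet> (A *\<^sub>v v))"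

(* Only the values of \<sigma> on {..<r} matter. *)

definition gram_decomposition ::
    "nat \<Rightarrow> nat \<Rightarrow> real mat \<Rightarrow> real mat \<Rightarrow> (nat \<Rightarrow> real) \<Rightarrow> bool" where
  "gram_decomposition N r A U \<sigma> \<longleftrightarrow>
     U \<in> carrier_mat N r \<and>
     transpose_mat U * U = 1\<^sub>m r \<and>
     (\<forall>p<r. \<sigma> p > 0) \<and>
     (\<forall>m<N. \<forall>n<N. A $$ (m, n) = (\<Sum>p<r. U $$ (m, p) * (\<sigma> p)\<^sup>2 * U $$ (n, p)))"

end

(* Everything is read off one decomposition A = U diag(sigma^2) U^T with U^T U = 1. The tensors
   Q_l are orthonormal and <Q_l, X_n> = sigma_l U_{n,l}; hence P_n = sum_l Q_l U_{n,l} sigma_l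
   satisfies |P_n|^2 = <P_n, X_n> = |X_n|^2 and X_n = P_n. So the Q_l form a basis of the span,
   which forces the number of columns of U to be r, and A has the column space of U.
   For existence, take a largest orthonormal family of eigenvectors of A with nonzero eigenvalues.
   If A minus its part on this family were nonzero, it would have a nonzero eigenvalue, and an
   eigenvector for it would enlarge the family. *)

theory Submission
  imports Defs "Jordan_Normal_Form.Schur_Decomposition"
begin

section \<open>Traces of similar and of triangular matrices\<close>

lemma sum_function_apply: "(\<Sum>x\<in>S. f x) y = (\<Sum>x\<in>S. f x y)"
  for f :: "'a \<Rightarrow> 'b \<Rightarrow> 'c::comm_monoid_add"
  by (induction S rule: infinite_finite_induct) auto

text \<open>Since \<open>A = P * (B * Q)\<close> and tr(CD) = tr(DC), the factor \<open>P\<close>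
  can be moved to the far right, where it cancels against \<open>Q\<close>.\<close>

lemma trace_similar:
  fixes A :: "'a::comm_ring_1 mat"
  assumes "similar_mat_wit A B P Q" and "A \<in> carrier_mat n n"
  shows "(\<Sum>i<n. A $$ (i, i)) = (\<Sum>i<n. B $$ (i, i))"
proof -
  note wit = similar_mat_witD2[OF assms(2,1)]
  have trace_comm: "(\<Sum>i<n. (C * D) $$ (i, i)) = (\<Sum>i<n. (D * C) $$ (i, i))"
    if "C \<in> carrier_mat n n" "D \<in> carrier_mat n n" for C D :: "'a mat"
  proof -
    have "(\<Sum>i<n. (C * D) $$ (i, i)) = (\<Sum>i<n. \<Sum>k<n. C $$ (i, k) * D $$ (k, i))"
      using that by (intro sum.cong refl) (auto simp: scalar_prod_def atLeast0LessThan)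
    also have "\<dots> = (\<Sum>k<n. \<Sum>i<n. D $$ (k, i) * C $$ (i, k))"
      by (subst sum.swap) (simp add: mult.commute)
    also have "\<dots> = (\<Sum>i<n. (D * C) $$ (i, i))"
      using that by (intro sum.cong refl) (auto simp: scalar_prod_def atLeast0LessThan)
    finally show ?thesis .
  qed
  have "(\<Sum>i<n. A $$ (i, i)) = (\<Sum>i<n. (P * (B * Q)) $$ (i, i))"
    using wit by (simp add: assoc_mult_mat[of _ n n _ n _ n])
  also have "\<dots> = (\<Sum>i<n. ((B * Q) * P) $$ (i, i))"
    using wit by (intro trace_comm) auto
  also have "(B * Q) * P = B"
    using wit by (simp add: assoc_mult_mat[of _ n n _ n _ n])
  finally show ?thesis .
qed

text \<open>For k different from i, one of the entries (i, k) and (k, i) lies below the diagonal, so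
  only the square of the diagonal entry survives in the i-th summand.\<close>

lemma trace_square_upper_triangular:
  fixes T :: "'a::comm_ring_1 mat"
  assumes T: "T \<in> carrier_mat n n" and tri: "upper_triangular T"
  shows "(\<Sum>i<n. (T * T) $$ (i, i)) = (\<Sum>i<n. (T $$ (i, i))\<^sup>2)"
proof (intro sum.cong refl)
  fix i assume "i \<in> {..<n}"
  then have i: "i < n" by simp
  have zero: "T $$ (i, k) * T $$ (k, i) = 0" if "k < n" "k \<noteq> i" for k
    using upper_triangularD[OF tri, of i k] upper_triangularD[OF tri, of k i] T i that
    by (cases k i rule: linorder_cases) auto
  have "(T * T) $$ (i, i) = (\<Sum>k<n. T $$ (i, k) * T $$ (k, i))"
    using T i by (auto simp: scalar_prod_def atLeast0LessThan)
  also have "\<dots> = (\<Sum>k\<in>{i}. T $$ (i, k) * T $$ (k, i))"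
    using i zero by (intro sum.mono_neutral_right) auto
  finally show "(T * T) $$ (i, i) = (T $$ (i, i))\<^sup>2"
    by (simp add: power2_eq_square)
qed

section \<open>Eigenvalues of real symmetric matrices\<close>

text \<open>Self-adjointness for the bilinear pairing, without conjugation. The generic type serves
  both real vectors and a complex vector paired with its conjugate.\<close>

lemma sum_mult_symmetric:
  fixes B :: "nat \<Rightarrow> nat \<Rightarrow> 'a::comm_semiring_0"
  assumes "\<And>i j. i < n \<Longrightarrow> j < n \<Longrightarrow> B i j = B j i"
  shows "(\<Sum>i<n. v i * (\<Sum>j<n. B i j * w j)) = (\<Sum>i<n. w i * (\<Sum>j<n. B i j * v j))"
proof -
  have "(\<Sum>i<n. v i * (\<Sum>j<n. B i j * w j)) = (\<Sum>i<n. \<Sum>j<n. v i * (B i j * w j))"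
    by (simp add: sum_distrib_left)
  also have "\<dots> = (\<Sum>j<n. \<Sum>i<n. v i * (B i j * w j))"
    by (rule sum.swap)
  also have "\<dots> = (\<Sum>j<n. w j * (\<Sum>i<n. B j i * v i))"
    using assms by (auto simp: sum_distrib_left mult_ac intro!: sum.cong)
  finally show ?thesis .
qed

text \<open>A nonzero real symmetric matrix is not nilpotent. Over the complex numbers it is
  triangularizable, and the trace of its square would vanish if all eigenvalues did.\<close>

lemma symmetric_complex_nonzero_eigenvalue:
  fixes B :: "nat \<Rightarrow> nat \<Rightarrow> real"
  assumes sym: "\<And>i j. i < n \<Longrightarrow> j < n \<Longrightarrow> B i j = B j i"
    and nz: "\<exists>i<n. \<exists>j<n. B i j \<noteq> 0"
  obtains e :: complex and z :: "nat \<Rightarrow> complex"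
  where "e \<noteq> 0" and "\<exists>i<n. z i \<noteq> 0"
    and "\<And>i. i < n \<Longrightarrow> (\<Sum>j<n. of_real (B i j) * z j) = e * z i"
proof -
  define C where "C = mat n n (\<lambda>(i, j). complex_of_real (B i j))"
  have C: "C \<in> carrier_mat n n" by (simp add: C_def)
  obtain es where es: "char_poly C = (\<Prod>a\<leftarrow>es. [:- a, 1:])"
    using char_poly_factorized[OF C] by auto
  obtain T P Q where "schur_decomposition C es = (T, P, Q)"
    by (metis prod_cases3)
  from schur_decomposition[OF C es this]
  have wit: "similar_mat_wit C T P Q" and tri: "upper_triangular T" and diag: "diag_mat T = es"
    by auto
  note T = similar_mat_witD2(5)[OF C wit]
  \<comment> \<open>The squared eigenvalues add up to the trace of \<open>C\<^sup>2\<close>, which is the sum of the squared entries.\<close>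
  have "similar_mat_wit (C ^\<^sub>m 2) (T ^\<^sub>m 2) P Q"
    by (rule similar_mat_wit_pow[OF wit])
  then have "similar_mat_wit (C * C) (T * T) P Q"
    using C T by (simp add: numeral_2_eq_2)
  then have "(\<Sum>i<n. (C * C) $$ (i, i)) = (\<Sum>i<n. (T * T) $$ (i, i))"
    by (rule trace_similar[OF _ mult_carrier_mat[OF C C]])
  also have "\<dots> = (\<Sum>i<n. (T $$ (i, i))\<^sup>2)"
    by (rule trace_square_upper_triangular[OF T tri])
  finally have tr: "(\<Sum>i<n. (C * C) $$ (i, i)) = (\<Sum>i<n. (T $$ (i, i))\<^sup>2)" .
  have "(\<Sum>i<n. (C * C) $$ (i, i)) = (\<Sum>i<n. \<Sum>k<n. of_real ((B i k)\<^sup>2))"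
    unfolding C_def by (auto simp: scalar_prod_def atLeast0LessThan power2_eq_square sym intro!: sum.cong)
  also have "\<dots> = of_real (\<Sum>i<n. \<Sum>k<n. (B i k)\<^sup>2)" by simp
  finally have "(\<Sum>i<n. (C * C) $$ (i, i)) = of_real (\<Sum>i<n. \<Sum>k<n. (B i k)\<^sup>2)" .
  moreover have "(\<Sum>i<n. \<Sum>k<n. (B i k)\<^sup>2) \<noteq> 0"
    using nz by (auto simp: sum_nonneg_eq_0_iff sum_nonneg)
  ultimately have "(\<Sum>i<n. (T $$ (i, i))\<^sup>2) \<noteq> 0"
    unfolding tr[symmetric] by (simp only: of_real_eq_0_iff not_False_eq_True)
  then obtain i where i: "i < n" "T $$ (i, i) \<noteq> 0"
    by (auto elim!: sum.not_neutral_contains_not_neutral)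
  define e where "e = T $$ (i, i)"
  \<comment> \<open>The diagonal of \<open>T\<close> is the list of roots of the characteristic
    polynomial, so its nonzero entry is an eigenvalue.\<close>
  have "e \<in> set es"
    unfolding diag[symmetric] e_def diag_mat_def using i T by auto
  then have "poly (char_poly C) e = 0"
    unfolding es poly_prod_list prod_list_zero_iff by force
  then have "eigenvalue C e"
    using eigenvalue_root_char_poly[OF C] by simp
  then obtain v where v: "v \<in> carrier_vec n" "v \<noteq> 0\<^sub>v n" "C *\<^sub>v v = e \<cdot>\<^sub>v v"
    using C unfolding eigenvalue_def eigenvector_def by auto
  show thesis
  proof
    show "e \<noteq> 0" using i by (simp add: e_def)
    show "\<exists>i<n. v $ i \<noteq> 0"
      using v(1,2) by (metis carrier_vecD eq_vecI index_zero_vec)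
    fix i assume "i < n"
    then show "(\<Sum>j<n. of_real (B i j) * v $ j) = e * v $ i"
      using arg_cong[OF v(3), of "\<lambda>w. w $ i"] v(1)
      by (simp add: C_def scalar_prod_def atLeast0LessThan)
  qed
qed

text \<open>The complex eigenvalue is real by self-adjointness, so the real and imaginary parts of
  its eigenvector satisfy the same real eigenvalue equation.\<close>

lemma symmetric_nonzero_eigenvalue:
  fixes B :: "nat \<Rightarrow> nat \<Rightarrow> real"
  assumes sym: "\<And>i j. i < n \<Longrightarrow> j < n \<Longrightarrow> B i j = B j i"
    and nz: "\<exists>i<n. \<exists>j<n. B i j \<noteq> 0"
  shows "\<exists>e u. e \<noteq> 0 \<and> (\<Sum>i<n. (u i)\<^sup>2) = 1 \<and> (\<forall>i<n. (\<Sum>j<n. B i j * u j) = e * u i)"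
proof -
  obtain e :: complex and z where e: "e \<noteq> 0" and z: "\<exists>i<n. z i \<noteq> 0"
    and ev: "\<And>i. i < n \<Longrightarrow> (\<Sum>j<n. of_real (B i j) * z j) = e * z i"
    using symmetric_complex_nonzero_eigenvalue[OF sym nz] by metis
  have cev: "(\<Sum>j<n. of_real (B i j) * cnj (z j)) = cnj e * cnj (z i)" if "i < n" for i
    using arg_cong[OF ev[OF that], of cnj] by simp
  define s where "s = (\<Sum>i<n. (cmod (z i))\<^sup>2)"
  have "s \<noteq> 0"
    using z unfolding s_def by (auto simp: sum_nonneg_eq_0_iff)
  have s: "complex_of_real s = (\<Sum>i<n. z i * cnj (z i))"
    by (simp add: s_def complex_norm_square del: of_real_power)
  \<comment> \<open>The Hermitian form of \<open>z\<close> is evaluated with the matrix acting first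
    on \<open>z\<close>, then on its conjugate; this gives \<open>e * s = cnj e * s\<close>.\<close>
  have "e * s = (\<Sum>i<n. cnj (z i) * (\<Sum>j<n. of_real (B i j) * z j))"
    unfolding s using ev by (auto simp: sum_distrib_left mult_ac intro!: sum.cong)
  also have "\<dots> = (\<Sum>i<n. z i * (\<Sum>j<n. of_real (B i j) * cnj (z j)))"
    by (rule sum_mult_symmetric) (simp add: sym)
  also have "\<dots> = cnj e * s"
    unfolding s using cev by (auto simp: sum_distrib_left mult_ac intro!: sum.cong)
  finally have "e = cnj e" using \<open>s \<noteq> 0\<close> by simp
  then have "Im e = 0" by (simp add: complex_eq_iff)
  then have e_real: "e = of_real (Re e)" by (simp add: complex_eq_iff)
  have parts: "(\<Sum>j<n. B i j * Re (z j)) = Re e * Re (z i)"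
      "(\<Sum>j<n. B i j * Im (z j)) = Re e * Im (z i)" if "i < n" for i
    using arg_cong[OF ev[OF that], of Re] arg_cong[OF ev[OF that], of Im] \<open>Im e = 0\<close> by simp_all
  \<comment> \<open>The real and imaginary parts of \<open>z\<close> cannot both vanish; whichever
    is nonzero serves as \<open>y\<close>.\<close>
  have "\<exists>y. (\<exists>i<n. y i \<noteq> 0) \<and> (\<forall>i<n. (\<Sum>j<n. B i j * y j) = Re e * y i)"
  proof (cases "\<exists>i<n. Re (z i) \<noteq> 0")
    case True
    then show ?thesis using parts by (intro exI[of _ "\<lambda>i. Re (z i)"]) auto
  next
    case False
    then have "\<exists>i<n. Im (z i) \<noteq> 0" using z by (auto simp: complex_eq_iff)
    then show ?thesis using parts by (intro exI[of _ "\<lambda>i. Im (z i)"]) auto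
  qed
  then obtain y where y: "\<exists>i<n. y i \<noteq> 0"
    and yev: "\<And>i. i < n \<Longrightarrow> (\<Sum>j<n. B i j * y j) = Re e * y i" by blast
  define t where "t = (\<Sum>i<n. (y i)\<^sup>2)"
  have "t > 0"
    using y unfolding t_def by (auto intro!: sum_pos2)
  show ?thesis
  proof (intro exI conjI allI impI)
    show "Re e \<noteq> 0" using e e_real by auto
    show "(\<Sum>i<n. (y i / sqrt t)\<^sup>2) = 1"
      using \<open>t > 0\<close> by (simp add: power_divide sum_divide_distrib[symmetric] t_def[symmetric])
    fix i assume "i < n"
    then show "(\<Sum>j<n. B i j * (y j / sqrt t)) = Re e * (y i / sqrt t)"
      using yev[of i] by (simp add: sum_divide_distrib[symmetric])
  qed
qed

section \<open>Spectral decomposition of symmetric matrices\<close>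

text \<open>Double counting of the squared entries: each of the m vectors contributes 1, while each
  of the n coordinates contributes at most 1 by Bessel's inequality. The bound is what makes a
  largest family of eigenvectors exist.\<close>

lemma orthonormal_family_card_le:
  fixes u :: "nat \<Rightarrow> nat \<Rightarrow> real"
  assumes orth: "\<And>k l. k < m \<Longrightarrow> l < m \<Longrightarrow> (\<Sum>i<n. u k i * u l i) = (if k = l then 1 else 0)"
  shows "m \<le> n"
proof -
  have bessel: "(\<Sum>k<m. (u k i)\<^sup>2) \<le> 1" if i: "i < n" for i
  proof -
    let ?p = "\<lambda>j. \<Sum>k<m. u k i * u k j" \<comment> \<open>projection of the \<open>i\<close>-th unit vector\<close>
    \<comment> \<open>Orthonormality collapses the sums: the squared norm of the projection equals
      its own i-th coordinate.\<close>
    have "(\<Sum>j<n. (?p j)\<^sup>2) = (\<Sum>j<n. \<Sum>k<m. \<Sum>l<m. (u k i * u l i) * (u k j * u l j))"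
      by (simp add: power2_eq_square sum_product mult_ac)
    also have "\<dots> = (\<Sum>k<m. \<Sum>j<n. \<Sum>l<m. (u k i * u l i) * (u k j * u l j))"
      by (rule sum.swap)
    also have "\<dots> = (\<Sum>k<m. \<Sum>l<m. (u k i * u l i) * (\<Sum>j<n. u k j * u l j))"
      unfolding sum_distrib_left by (intro sum.cong refl sum.swap)
    also have "\<dots> = (\<Sum>k<m. \<Sum>l<m. if l = k then (u k i)\<^sup>2 else 0)"
      using orth by (intro sum.cong refl) (auto simp: power2_eq_square)
    also have "\<dots> = (\<Sum>k<m. (u k i)\<^sup>2)" by simp
    finally have sq: "(\<Sum>j<n. (?p j)\<^sup>2) = ?p i" by (simp add: power2_eq_square)
    \<comment> \<open>One squared coordinate is at most the squared norm, so x = \<open>?p i\<close>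
      satisfies x * x \<le> x; as x \<ge> 0, this forces x \<le> 1.\<close>
    have "(?p i)\<^sup>2 \<le> (\<Sum>j<n. (?p j)\<^sup>2)"
      using i by (intro member_le_sum) auto
    then have "?p i * ?p i \<le> ?p i * 1" unfolding sq by (simp add: power2_eq_square)
    moreover have "0 \<le> ?p i" by (intro sum_nonneg) auto
    ultimately have "?p i \<le> 1"
      using mult_le_cancel_left_pos[of "?p i" "?p i" 1] by linarith
    then show ?thesis by (simp add: power2_eq_square)
  qed
  have "real m = (\<Sum>k<m. \<Sum>i<n. (u k i)\<^sup>2)"
    using orth by (simp add: power2_eq_square)
  also have "\<dots> = (\<Sum>i<n. \<Sum>k<m. (u k i)\<^sup>2)" by (rule sum.swap)
  also have "\<dots> \<le> (\<Sum>i<n. 1)" using bessel by (intro sum_mono) auto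
  finally show ?thesis by simp
qed

text \<open>Maximality of a family of eigenvectors takes the place of an induction on the dimension.
  Listing only nonzero eigenvalues lets \<open>m\<close> come out as the rank, and not as the size
  of the matrix.\<close>

lemma symmetric_spectral_decomposition:
  fixes A :: "nat \<Rightarrow> nat \<Rightarrow> real"
  assumes sym: "\<And>i j. i < n \<Longrightarrow> j < n \<Longrightarrow> A i j = A j i"
  shows "\<exists>(m::nat) u e. (\<forall>k<m. \<forall>l<m. (\<Sum>i<n. u k i * u l i) = (if k = l then 1 else 0)) \<and>
    (\<forall>k<m. e k \<noteq> 0) \<and> (\<forall>i<n. \<forall>j<n. A i j = (\<Sum>k<m. e k * u k i * u k j))"
proof -
  define ok where "ok m u e \<longleftrightarrow>
      (\<forall>k<m. \<forall>l<m. (\<Sum>i<n. u k i * u l i) = (if k = l then 1 else 0)) \<and>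
      (\<forall>k<m. e k \<noteq> 0 \<and> (\<forall>i<n. (\<Sum>j<n. A i j * u k j) = e k * u k i))"
    for m :: nat and u :: "nat \<Rightarrow> nat \<Rightarrow> real" and e :: "nat \<Rightarrow> real"
  \<comment> \<open>The empty family qualifies and the sizes are bounded by \<open>n\<close>, so a
    greatest size exists.\<close>
  have "\<exists>u e. ok 0 u e" by (simp add: ok_def)
  moreover have "m \<le> n" if "\<exists>u e. ok m u e" for m
    using that unfolding ok_def using orthonormal_family_card_le by metis
  ultimately have "\<exists>m. (\<exists>u e. ok m u e) \<and> (\<forall>m'. (\<exists>u e. ok m' u e) \<longrightarrow> m' \<le> m)"
    using ex_has_greatest_nat[of "\<lambda>m. \<exists>u e. ok m u e" 0 "\<lambda>m. m" "Suc n"]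
    by (simp add: less_Suc_eq_le)
  then obtain m u e where ok: "ok m u e" and max: "\<And>m' u e. ok m' u e \<Longrightarrow> m' \<le> m" by blast
  note orth = ok[unfolded ok_def, THEN conjunct1, rule_format]
  have e: "e k \<noteq> 0" and ev: "i < n \<Longrightarrow> (\<Sum>j<n. A i j * u k j) = e k * u k i" if "k < m" for k i
    using ok that by (auto simp: ok_def)
  \<comment> \<open>\<open>B\<close> is what remains of \<open>A\<close> after its part on the
    family is removed; the aim is to show that it vanishes.\<close>
  define B where "B i j = A i j - (\<Sum>k<m. e k * u k i * u k j)" for i j
  have B_sym: "B i j = B j i" if "i < n" "j < n" for i j
    using sym that by (simp add: B_def mult_ac)
  have B_apply: "(\<Sum>j<n. B i j * v j)
      = (\<Sum>j<n. A i j * v j) - (\<Sum>k<m. e k * u k i * (\<Sum>j<n. u k j * v j))" for i v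
  proof -
    have "(\<Sum>j<n. (\<Sum>k<m. e k * u k i * u k j) * v j)
        = (\<Sum>k<m. e k * u k i * (\<Sum>j<n. u k j * v j))"
      unfolding sum_distrib_left sum_distrib_right
      by (subst sum.swap) (simp add: mult_ac)
    then show ?thesis
      by (simp add: B_def left_diff_distrib sum_subtractf)
  qed
  \<comment> \<open>On \<open>u l\<close> the removed part acts as multiplication by
    \<open>e l\<close>, exactly as \<open>A\<close> does.\<close>
  have Bu: "(\<Sum>j<n. B i j * u l j) = 0" if "i < n" "l < m" for i l
  proof -
    have "(\<Sum>k<m. e k * u k i * (\<Sum>j<n. u k j * u l j)) = (\<Sum>k<m. if k = l then e l * u l i else 0)"
      using orth that by (intro sum.cong) auto
    then show ?thesis using that by (simp add: B_apply ev)
  qed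
  have "B i j = 0" if ij: "i < n" "j < n" for i j
  proof (rule ccontr)
    assume "B i j \<noteq> 0"
    then have nz: "\<exists>i<n. \<exists>j<n. B i j \<noteq> 0" using ij by blast
    from symmetric_nonzero_eigenvalue[OF B_sym nz]
    obtain c v where c: "c \<noteq> 0" and v: "(\<Sum>i<n. (v i)\<^sup>2) = 1"
      and "\<forall>i<n. (\<Sum>j<n. B i j * v j) = c * v i"
      by blast
    then have Bv: "(\<Sum>j<n. B i j * v j) = c * v i" if "i < n" for i using that by blast
    \<comment> \<open>Moving \<open>B\<close> from \<open>v\<close> to \<open>u l\<close>, which it
      annihilates, gives \<open>c\<close> times the inner product equal to 0, and \<open>c\<close>
      is nonzero.\<close>
    have uv: "(\<Sum>i<n. u l i * v i) = 0" if "l < m" for l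
    proof -
      have "c * (\<Sum>i<n. u l i * v i) = (\<Sum>i<n. u l i * (\<Sum>j<n. B i j * v j))"
        using Bv by (auto simp: sum_distrib_left mult_ac intro!: sum.cong)
      also have "\<dots> = (\<Sum>i<n. v i * (\<Sum>j<n. B i j * u l j))"
        by (rule sum_mult_symmetric) (rule B_sym)
      also have "\<dots> = 0" using Bu that by simp
      finally show ?thesis using c by simp
    qed
    \<comment> \<open>As \<open>v\<close> is orthogonal to the family, the removed part kills it,
      and \<open>v\<close> is an eigenvector of \<open>A\<close> itself.\<close>
    have Av: "(\<Sum>j<n. A i j * v j) = c * v i" if "i < n" for i
      using Bv[OF that] uv by (simp add: B_apply)
    have vu: "(\<Sum>i<n. v i * u l i) = 0" if "l < m" for l
      using uv[OF that] by (simp add: mult.commute)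
    have vv: "(\<Sum>i<n. v i * v i) = 1"
      using v by (simp add: power2_eq_square)
    \<comment> \<open>The family is extended by \<open>v\<close> at the first free index
      \<open>m\<close>, contradicting the choice of \<open>m\<close>.\<close>
    have "(\<Sum>i<n. (u(m := v)) k i * (u(m := v)) l i) = (if k = l then 1 else 0)"
      if "k < Suc m" "l < Suc m" for k l
    proof (cases "k = m")
      case True
      show ?thesis
        by (cases "l = m") (use that True vu[of l] vv in simp_all)
    next
      case False
      then have "k < m" using that by simp
      then show ?thesis
        by (cases "l = m") (use that uv[of k] orth[of k l] in simp_all)
    qed
    moreover have "(e(m := c)) k \<noteq> 0 \<and>
        (\<forall>i<n. (\<Sum>j<n. A i j * (u(m := v)) k j) = (e(m := c)) k * (u(m := v)) k i)"
      if "k < Suc m" for k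
    proof (cases "k = m")
      case True
      then show ?thesis using c Av by simp
    next
      case False
      then have "k < m" using that by simp
      then show ?thesis using e ev by simp
    qed
    ultimately have "ok (Suc m) (u(m := v)) (e(m := c))"
      unfolding ok_def by blast
    from max[OF this] show False by simp
  qed
  then have "A i j = (\<Sum>k<m. e k * u k i * u k j)" if "i < n" "j < n" for i j
    using that by (simp add: B_def)
  with orth e show ?thesis by (intro exI[of _ m] exI[of _ u] exI[of _ e]) simp
qed

text \<open>Each nonzero eigenvalue is the value of the quadratic form at its unit eigenvector,
  hence positive, and its square root serves as the singular value. The number \<open>m\<close> of
  columns stays open here; it is identified with the dimension of the span later.\<close>

lemma positive_semidefinite_gram_decomposition:
  assumes A: "A \<in> carrier_mat n n" and sym: "transpose_mat A = A"
    and psd: "positive_semidefinite A"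
  shows "\<exists>m U \<sigma>. gram_decomposition n m A U \<sigma>"
proof -
  have "A $$ (i, j) = A $$ (j, i)" if "i < n" "j < n" for i j
    using arg_cong[OF sym, of "\<lambda>M. M $$ (i, j)"] A that by simp
  from symmetric_spectral_decomposition[of n "\<lambda>i j. A $$ (i, j)", OF this]
  obtain m :: nat and u e
    where "\<forall>k<m. \<forall>l<m. (\<Sum>i<n. u k i * u l i) = (if k = l then 1 else 0)"
      and "\<forall>k<m. e k \<noteq> 0"
      and "\<forall>i<n. \<forall>j<n. A $$ (i, j) = (\<Sum>k<m. e k * u k i * u k j)"
    by blast
  note orth = this(1)[rule_format] and e = this(2)[rule_format] and A_eq = this(3)[rule_format]
  have e_pos: "e l > 0" if l: "l < m" for l
  proof -
    define v where "v = vec n (u l)"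
    have Av: "(A *\<^sub>v v) $ i = e l * u l i" if i: "i < n" for i
    proof -
      have "(A *\<^sub>v v) $ i = (\<Sum>j<n. \<Sum>k<m. e k * u k i * (u k j * u l j))"
        using A i by (simp add: v_def scalar_prod_def atLeast0LessThan A_eq sum_distrib_left sum_distrib_right mult_ac)
      also have "\<dots> = (\<Sum>k<m. e k * u k i * (\<Sum>j<n. u k j * u l j))"
        by (subst sum.swap) (simp add: sum_distrib_left)
      also have "\<dots> = (\<Sum>k<m. if k = l then e l * u l i else 0)"
        using orth l by (intro sum.cong) auto
      finally show ?thesis using l by simp
    qed
    have "v \<bullet> (A *\<^sub>v v) = (\<Sum>i<n. u l i * (e l * u l i))"
      using A Av by (simp add: scalar_prod_def atLeast0LessThan v_def)
    also have "\<dots> = e l * (\<Sum>i<n. u l i * u l i)"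
      by (simp add: sum_distrib_left mult_ac)
    finally have "v \<bullet> (A *\<^sub>v v) = e l" using orth l by simp
    moreover have "0 \<le> v \<bullet> (A *\<^sub>v v)"
      using psd A by (simp add: positive_semidefinite_def v_def)
    ultimately show ?thesis using e[OF l] by simp
  qed
  define U where "U = mat n m (\<lambda>(i, k). u k i)"
  have "transpose_mat U * U = 1\<^sub>m m"
    using orth by (intro eq_matI) (auto simp: U_def scalar_prod_def atLeast0LessThan)
  moreover have "A $$ (i, j) = (\<Sum>p<m. U $$ (i, p) * (sqrt (e p))\<^sup>2 * U $$ (j, p))"
    if "i < n" "j < n" for i j
    using that e_pos by (auto simp: A_eq U_def less_imp_le mult_ac intro!: sum.cong)
  ultimately have "gram_decomposition n m A U (\<lambda>p. sqrt (e p))"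
    using e_pos by (simp add: gram_decomposition_def U_def)
  then show ?thesis by blast
qed

section \<open>Inner products and orthonormal families of tensors\<close>

lemma tensor_inner_commute: "tensor_inner d I S T = tensor_inner d I T S"
  by (simp add: tensor_inner_def mult.commute)

lemma tensor_inner_sum_left:
  "tensor_inner d I (\<lambda>i. \<Sum>k\<in>K. S k i * c k) T = (\<Sum>k\<in>K. tensor_inner d I (S k) T * c k)"
  unfolding tensor_inner_def sum_distrib_right
  by (subst sum.swap) (simp add: mult_ac)

lemma tensor_inner_sum_right:
  "tensor_inner d I T (\<lambda>i. \<Sum>k\<in>K. S k i * c k) = (\<Sum>k\<in>K. tensor_inner d I T (S k) * c k)"
  using tensor_inner_sum_left by (simp add: tensor_inner_commute[of d I T])

lemma tensor_inner_diff_left: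
  "tensor_inner d I (\<lambda>i. S i - S' i) T = tensor_inner d I S T - tensor_inner d I S' T"
  by (simp add: tensor_inner_def left_diff_distrib sum_subtractf)

lemma tensor_inner_diff_right:
  "tensor_inner d I T (\<lambda>i. S i - S' i) = tensor_inner d I T S - tensor_inner d I T S'"
  by (simp add: tensor_inner_def right_diff_distrib sum_subtractf)

lemma tensor_inner_self_eq_0:
  assumes "tensor_inner d I T T = 0" "i \<in> multi_indices d I"
  shows "T i = 0"
proof -
  \<comment> \<open>Finiteness matters: a sum over an infinite set is 0 by convention and would say
    nothing about the entries.\<close>
  have "finite (multi_indices d I)" by (simp add: multi_indices_def finite_PiE)
  then show ?thesis using assms by (auto simp: tensor_inner_def sum_nonneg_eq_0_iff)
qed

text \<open>Pairing a linear relation with \<open>Q l\<close> isolates the l-th coefficient; equal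
  tensors at different indices would give 0 = 1.\<close>

lemma orthonormal_tensors_independent:
  assumes "orthonormal_tensors d I r Q"
  shows "inj_on Q {..<r}" and "independent (Q ` {..<r})"
proof -
  have QQ: "tensor_inner d I (Q k) (Q l) = (if k = l then 1 else 0)" if "k < r" "l < r" for k l
    using assms that by (simp add: orthonormal_tensors_def)
  show inj: "inj_on Q {..<r}"
    by (rule inj_onI) (metis QQ lessThan_iff zero_neq_one)
  show "independent (Q ` {..<r})"
  proof (rule real_vector.independent_if_scalars_zero)
    fix f T assume f: "(\<Sum>T\<in>Q ` {..<r}. f T *\<^sub>R T) = 0" and "T \<in> Q ` {..<r}"
    then obtain l where l: "l < r" "T = Q l" by auto
    \<comment> \<open>Injectivity turns the sum over the set of tensors into a sum over their
      indices.\<close>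
    have "(\<Sum>k<r. f (Q k) *\<^sub>R Q k) = 0" using f inj by (simp add: sum.reindex)
    then have "(\<lambda>i. \<Sum>k<r. Q k i * f (Q k)) = (\<lambda>i. 0)"
      by (simp add: fun_eq_iff sum_function_apply mult.commute)
    then have "0 = tensor_inner d I (\<lambda>i. \<Sum>k<r. Q k i * f (Q k)) (Q l)"
      by (simp add: tensor_inner_def)
    also have "\<dots> = (\<Sum>k<r. if k = l then f (Q l) else 0)"
      unfolding tensor_inner_sum_left using QQ l by (intro sum.cong) auto
    finally show "f T = 0" using l by simp
  qed simp
qed

section \<open>Symmetry and positivity of the Gram matrix\<close>

lemma gram_matrix_symmetric: "transpose_mat (gram_matrix d I N X) = gram_matrix d I N X"
  by (rule eq_matI) (auto simp: gram_matrix_def tensor_inner_commute)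

text \<open>The quadratic form at \<open>v\<close> is the squared norm of the combination of the
  \<open>X n\<close> with coefficients \<open>v $ n\<close>.\<close>

lemma gram_matrix_positive_semidefinite: "positive_semidefinite (gram_matrix d I N X)"
  unfolding positive_semidefinite_def
proof
  let ?A = "gram_matrix d I N X"
  fix v :: "real vec" assume "v \<in> carrier_vec (dim_row ?A)"
  then have v: "dim_vec v = N" by (simp add: gram_matrix_def)
  define T where "T = (\<lambda>i. \<Sum>n<N. X n i * v $ n)"
  have "v \<bullet> (?A *\<^sub>v v) = (\<Sum>m<N. v $ m * (\<Sum>n<N. tensor_inner d I (X m) (X n) * v $ n))"
    using v by (simp add: gram_matrix_def scalar_prod_def atLeast0LessThan)
  also have "\<dots> = tensor_inner d I T T"
    unfolding T_def tensor_inner_sum_left tensor_inner_sum_right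
    by (simp add: mult.commute)
  also have "\<dots> \<ge> 0" by (simp add: tensor_inner_def sum_nonneg)
  finally show "0 \<le> v \<bullet> (?A *\<^sub>v v)" .
qed

section \<open>Rank of a decomposed matrix\<close>

lemma gram_decomposition_orthonormal:
  assumes "gram_decomposition N r A U \<sigma>" and "k < r" "l < r"
  shows "(\<Sum>n<N. U $$ (n, k) * U $$ (n, l)) = (if k = l then 1 else 0)"
proof -
  have U: "U \<in> carrier_mat N r" and "transpose_mat U * U = 1\<^sub>m r"
    using assms(1) by (auto simp: gram_decomposition_def)
  then have "(transpose_mat U * U) $$ (k, l) = 1\<^sub>m r $$ (k, l)" by simp
  then show ?thesis
    using U assms(2,3) by (simp add: scalar_prod_def atLeast0LessThan)
qed

text \<open>With \<open>S\<close> the diagonal matrix of the squares,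
  \<open>A = U * (S * transpose_mat U)\<close> and \<open>U = A * (U * S')\<close>, so
  \<open>A\<close> and \<open>U\<close> have the same column space. The columns of \<open>U\<close>
  are independent because \<open>transpose_mat U\<close> is a left inverse.\<close>

lemma gram_decomposition_rank:
  fixes A :: "real mat"
  assumes A: "A \<in> carrier_mat N N" and dec: "gram_decomposition N r A U \<sigma>"
  shows "vec_space.rank N A = r"
proof -
  interpret vec_space "TYPE(real)" N .
  have U: "U \<in> carrier_mat N r" and UU: "transpose_mat U * U = 1\<^sub>m r"
    and \<sigma>: "\<And>p. p < r \<Longrightarrow> \<sigma> p > 0"
    and A_eq: "\<And>m n. m < N \<Longrightarrow> n < N \<Longrightarrow>
        A $$ (m, n) = (\<Sum>p<r. U $$ (m, p) * (\<sigma> p)\<^sup>2 * U $$ (n, p))"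
    using dec by (auto simp: gram_decomposition_def)
  define S where "S = mat r r (\<lambda>(p, q). if p = q then (\<sigma> p)\<^sup>2 else 0)"
  define S' where "S' = mat r r (\<lambda>(p, q). if p = q then inverse ((\<sigma> p)\<^sup>2) else 0)"
  have SS': "S \<in> carrier_mat r r" "S' \<in> carrier_mat r r" by (auto simp: S_def S'_def)
  have S_inv: "S * S' = 1\<^sub>m r"
  proof (intro eq_matI)
    fix p q assume pq: "p < dim_row (1\<^sub>m r)" "q < dim_col (1\<^sub>m r)"
    have "(S * S') $$ (p, q) = (\<Sum>k<r. S $$ (p, k) * S' $$ (k, q))"
      using SS' pq by (simp add: scalar_prod_def atLeast0LessThan)
    also have "\<dots> = (\<Sum>k<r. if k = p then (if p = q then 1 else 0) else 0)"
      using pq \<sigma> by (intro sum.cong refl) (auto simp: S_def S'_def right_inverse dest!: \<sigma>)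
    finally show "(S * S') $$ (p, q) = 1\<^sub>m r $$ (p, q)" using pq by simp
  qed (use SS' in auto)
  have USU: "A = U * (S * transpose_mat U)"
  proof (intro eq_matI)
    fix m n assume "m < dim_row (U * (S * transpose_mat U))" "n < dim_col (U * (S * transpose_mat U))"
    then have mn: "m < N" "n < N" using U by auto
    have "(S * transpose_mat U) $$ (p, n) = (\<sigma> p)\<^sup>2 * U $$ (n, p)" if p: "p < r" for p
    proof -
      have "(S * transpose_mat U) $$ (p, n) = (\<Sum>q<r. S $$ (p, q) * U $$ (n, q))"
        using SS' U p mn by (simp add: scalar_prod_def atLeast0LessThan)
      also have "\<dots> = (\<Sum>q<r. if q = p then (\<sigma> p)\<^sup>2 * U $$ (n, p) else 0)"
        using p by (intro sum.cong refl) (auto simp: S_def)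
      finally show ?thesis using p by simp
    qed
    moreover have "(U * (S * transpose_mat U)) $$ (m, n)
        = (\<Sum>p<r. U $$ (m, p) * (S * transpose_mat U) $$ (p, n))"
      using U SS' mn by (simp add: scalar_prod_def atLeast0LessThan)
    ultimately show "A $$ (m, n) = (U * (S * transpose_mat U)) $$ (m, n)"
      using mn by (simp add: A_eq mult.assoc)
  qed (use A U in auto)
  have U_eq: "U = A * (U * S')"
  proof -
    have "A * (U * S') = U * (S * ((transpose_mat U * U) * S'))"
      unfolding USU using U SS'
      by (simp add: assoc_mult_mat[of _ N r _ N _ r] assoc_mult_mat[of _ r r _ N _ r]
          assoc_mult_mat[of _ r N _ r _ r])
    then show ?thesis using U SS' UU S_inv by simp
  qed
  \<comment> \<open>A vector of the form (BC)x is B applied to Cx.\<close>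
  have sub: "col_space (B * C) \<subseteq> col_space B"
    if "B \<in> carrier_mat N k" "C \<in> carrier_mat k l" for B C :: "real mat" and k l
  proof -
    have "(B * C) *\<^sub>v x = B *\<^sub>v (C *\<^sub>v x)" if "x \<in> carrier_vec l" for x
      using that \<open>B \<in> _\<close> \<open>C \<in> _\<close> by (simp add: assoc_mult_mat_vec)
    then show ?thesis using that
      by (subst (1 2) col_space_eq) (auto intro!: bexI[of _ "C *\<^sub>v _"])
  qed
  have "S * transpose_mat U \<in> carrier_mat r N" "U * S' \<in> carrier_mat N r"
    using U SS' by auto
  from sub[OF U this(1)] sub[OF A this(2)]
  have "col_space A \<subseteq> col_space U" "col_space U \<subseteq> col_space A"
    by (simp_all only: USU[symmetric] U_eq[symmetric])
  then have "rank A = rank U"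
    by (simp add: rank_def col_space_def)
  also have "rank U = r"
  proof (rule lin_indpt_full_rank[OF U])
    \<comment> \<open>Independence is stated for the set of columns, so repeated columns have to be
      excluded separately; they would have inner product both 1 and 0.\<close>
    show dist: "distinct (cols U)"
      unfolding distinct_conv_nth
    proof (intro allI impI)
      fix k l assume kl: "k < length (cols U)" "l < length (cols U)" "k \<noteq> l"
      then have "(\<Sum>n<N. U $$ (n, k) * U $$ (n, k)) \<noteq> (\<Sum>n<N. U $$ (n, k) * U $$ (n, l))"
        using U gram_decomposition_orthonormal[OF dec] by simp
      moreover have "U $$ (n, k) = U $$ (n, l)" if "col U k = col U l" "n < N" for n
        using arg_cong[OF that(1), of "\<lambda>v. v $ n"] that(2) U kl by simp
      ultimately show "cols U ! k \<noteq> cols U ! l" using kl by fastforce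
    qed
    show "lin_indpt (set (cols U))"
    proof
      assume "lin_dep (set (cols U))"
      then obtain v where v: "v \<in> carrier_vec r" "v \<noteq> 0\<^sub>v r" "U *\<^sub>v v = 0\<^sub>v N"
        using lin_depE[OF U _ dist] by blast
      \<comment> \<open>The left inverse recovers \<open>v\<close> from
        \<open>U *\<^sub>v v\<close>, which is zero.\<close>
      have "v = (transpose_mat U * U) *\<^sub>v v" using v UU by simp
      also have "\<dots> = transpose_mat U *\<^sub>v (U *\<^sub>v v)"
        using U v by (simp add: assoc_mult_mat_vec[of _ r N _ r])
      also have "\<dots> = 0\<^sub>v r" using U v by auto
      finally show False using v by simp
    qed
  qed
  finally show ?thesis .
qed

section \<open>The orthonormal basis given by a decomposition\<close>

text \<open>Here \<open>r\<close> is just the number of columns of \<open>U\<close>; that it is the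
  dimension follows from the conclusion. The expansion of \<open>X n\<close> holds at every
  \<open>i\<close>, also off the index set, as equality of spans of functions requires.\<close>

lemma gram_decomposition_tensor_basis:
  assumes X: "\<And>n. n < N \<Longrightarrow> X n \<in> tensors d I"
    and dec: "gram_decomposition N r (gram_matrix d I N X) U \<sigma>"
  defines "Q \<equiv> \<lambda>l i. \<Sum>n<N. X n i * (U $$ (n, l) * inverse (\<sigma> l))"
  shows "orthonormal_tensor_basis d I r Q (span (X ` {..<N}))"
    and "\<And>n i. n < N \<Longrightarrow> X n i = (\<Sum>l<r. Q l i * U $$ (n, l) * \<sigma> l)"
proof -
  have \<sigma>: "\<sigma> p > 0" if "p < r" for p
    using dec that by (simp add: gram_decomposition_def)
  have XX: "tensor_inner d I (X m) (X n) = (\<Sum>p<r. U $$ (m, p) * (\<sigma> p)\<^sup>2 * U $$ (n, p))"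
    if "m < N" "n < N" for m n
    using dec that by (simp add: gram_decomposition_def gram_matrix_def)
  note orth = gram_decomposition_orthonormal[OF dec]
  \<comment> \<open>Orthonormality of the columns leaves only p = l, where the square of
    \<open>\<sigma> l\<close> meets its inverse.\<close>
  have QX: "tensor_inner d I (Q l) (X n) = \<sigma> l * U $$ (n, l)" if ln: "l < r" "n < N" for l n
  proof -
    have "tensor_inner d I (Q l) (X n) = (\<Sum>m<N. \<Sum>p<r.
        (U $$ (m, p) * U $$ (m, l)) * ((\<sigma> p)\<^sup>2 * U $$ (n, p) * inverse (\<sigma> l)))"
      unfolding Q_def tensor_inner_sum_left
      using ln by (simp add: XX sum_distrib_left sum_distrib_right mult_ac)
    also have "\<dots> = (\<Sum>p<r. (\<Sum>m<N. U $$ (m, p) * U $$ (m, l)) *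
        ((\<sigma> p)\<^sup>2 * U $$ (n, p) * inverse (\<sigma> l)))"
      by (subst sum.swap) (simp add: sum_distrib_right)
    also have "\<dots> = (\<Sum>p<r. if p = l then \<sigma> l * U $$ (n, l) else 0)"
      using orth ln \<sigma>[of l] by (intro sum.cong refl) (auto simp: power2_eq_square)
    finally show ?thesis using ln by simp
  qed
  have QQ: "tensor_inner d I (Q k) (Q l) = (if k = l then 1 else 0)" if kl: "k < r" "l < r" for k l
  proof -
    have "tensor_inner d I (Q k) (Q l)
        = (\<Sum>n<N. tensor_inner d I (Q k) (X n) * (U $$ (n, l) * inverse (\<sigma> l)))"
      by (subst (2) Q_def) (rule tensor_inner_sum_right)
    also have "\<dots> = (\<Sum>n<N. U $$ (n, k) * U $$ (n, l)) * (\<sigma> k * inverse (\<sigma> l))"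
      using kl by (simp add: QX sum_distrib_left sum_distrib_right mult_ac)
    finally show ?thesis using orth kl \<sigma>[of l] by simp
  qed
  then have orthoQ: "orthonormal_tensors d I r Q" by (simp add: orthonormal_tensors_def)
  show recon: "X n i = (\<Sum>l<r. Q l i * U $$ (n, l) * \<sigma> l)" if n: "n < N" for n i
  proof (cases "i \<in> multi_indices d I")
    \<comment> \<open>Off the index set all \<open>X m\<close> vanish, hence so do the
      \<open>Q l\<close> and both sides.\<close>
    case False
    then have "X m i = 0" if "m < N" for m using X[OF that] by (simp add: tensors_def)
    then show ?thesis using n by (simp add: Q_def)
  next
    case True
    \<comment> \<open>\<open>P\<close> is the claimed expansion. Its squared norm and its inner
      product with \<open>X n\<close> both equal the squared norm of \<open>X n\<close>, so
      \<open>X n\<close> - \<open>P\<close> has norm zero.\<close>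
    define P where "P = (\<lambda>i. \<Sum>l<r. Q l i * (U $$ (n, l) * \<sigma> l))"
    have PX: "tensor_inner d I P (X n) = tensor_inner d I (X n) (X n)"
      unfolding P_def tensor_inner_sum_left
      using n by (simp add: QX XX power2_eq_square mult_ac)
    have "tensor_inner d I P P
        = (\<Sum>k<r. \<Sum>l<r. if l = k then (U $$ (n, k) * \<sigma> k) * (U $$ (n, k) * \<sigma> k) else 0)"
      unfolding P_def tensor_inner_sum_left tensor_inner_sum_right sum_distrib_right
      by (intro sum.cong refl) (simp add: QQ)
    also have "\<dots> = tensor_inner d I (X n) (X n)"
      using n by (simp add: XX power2_eq_square mult_ac)
    finally have "tensor_inner d I (\<lambda>i. X n i - P i) (\<lambda>i. X n i - P i) = 0"
      using PX by (simp add: tensor_inner_diff_left tensor_inner_diff_right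
          tensor_inner_commute[of d I "X n" P])
    from tensor_inner_self_eq_0[OF this True] show ?thesis by (simp add: P_def mult.assoc)
  qed
  \<comment> \<open>One inclusion is the definition of \<open>Q\<close>, the other the expansion
    just proved.\<close>
  have "span (Q ` {..<r}) = span (X ` {..<N})"
    unfolding real_vector.span_eq
  proof (intro conjI subsetI)
    fix T assume "T \<in> Q ` {..<r}"
    then obtain l where "T = Q l" by auto
    then have "T = (\<Sum>n<N. (U $$ (n, l) * inverse (\<sigma> l)) *\<^sub>R X n)"
      by (auto simp: Q_def sum_function_apply mult.commute)
    moreover have "\<dots> \<in> span (X ` {..<N})"
      by (rule real_vector.span_sum, rule real_vector.span_scale, rule real_vector.span_base) simp
    ultimately show "T \<in> span (X ` {..<N})" by simp
  next
    fix T assume "T \<in> X ` {..<N}"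
    then obtain n where "n < N" "T = X n" by auto
    then have "T = (\<Sum>l<r. (U $$ (n, l) * \<sigma> l) *\<^sub>R Q l)"
      by (auto simp: fun_eq_iff sum_function_apply recon mult_ac)
    moreover have "\<dots> \<in> span (Q ` {..<r})"
      by (rule real_vector.span_sum, rule real_vector.span_scale, rule real_vector.span_base) simp
    ultimately show "T \<in> span (Q ` {..<r})" by simp
  qed
  then show "orthonormal_tensor_basis d I r Q (span (X ` {..<N}))"
    using orthoQ orthonormal_tensors_independent[OF orthoQ]
    by (simp add: orthonormal_tensor_basis_def)
qed

section \<open>Dimension of the span, rank and arbitrary decompositions\<close>

theorem mainTheorem5:
  fixes d N r :: nat and I :: "nat \<Rightarrow> nat" and X :: "nat \<Rightarrow> tensor"
  assumes "d \<ge> 1"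
    and "\<And>k. k < d \<Longrightarrow> I k \<ge> 1"
    and "1 \<le> N" and "N < (\<Prod>k<d. I k)"
    and "\<And>n. n < N \<Longrightarrow> X n \<in> tensors d I"
    and "dim (span (X ` {..<N})) = r" and "r \<ge> 1"
  defines "A \<equiv> gram_matrix d I N X"
  shows "transpose_mat A = A \<and> positive_semidefinite A \<and> vec_space.rank N A = r \<and>
    (\<exists>U \<sigma>. gram_decomposition N r A U \<sigma>) \<and>
    (\<forall>U \<sigma>. gram_decomposition N r A U \<sigma> \<longrightarrow>
       (let b = (\<lambda>n l. U $$ (n, l) * inverse (\<sigma> l));
            Q = (\<lambda>l i. \<Sum>n<N. X n i * b n l)
        in orthonormal_tensor_basis d I r Q (span (X ` {..<N})) \<and>
           (\<forall>n<N. \<forall>i\<in>multi_indices d I. X n i = (\<Sum>l<r. Q l i * U $$ (n, l) * \<sigma> l))))"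
proof -
  have A: "A \<in> carrier_mat N N" by (simp add: A_def gram_matrix_def)
  have sym: "transpose_mat A = A" and psd: "positive_semidefinite A"
    unfolding A_def by (rule gram_matrix_symmetric gram_matrix_positive_semidefinite)+
  obtain r' U \<sigma> where dec: "gram_decomposition N r' A U \<sigma>"
    using positive_semidefinite_gram_decomposition[OF A sym psd] by blast
  \<comment> \<open>The spectral decomposition comes with an unknown number \<open>r'\<close> of
    columns; the basis that it yields has \<open>r'\<close> elements, so \<open>r'\<close> is the
    dimension.\<close>
  have "dim (span (X ` {..<N})) = r'"
  proof -
    obtain Q where "orthonormal_tensor_basis d I r' Q (span (X ` {..<N}))"
      using gram_decomposition_tensor_basis(1)[OF assms(5) dec[unfolded A_def]] by blast
    then have "inj_on Q {..<r'}" "independent (Q ` {..<r'})" "span (Q ` {..<r'}) = span (X ` {..<N})"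
      by (auto simp: orthonormal_tensor_basis_def)
    then show ?thesis
      by (metis card_image card_lessThan real_vector.dim_span real_vector.dim_eq_card_independent)
  qed
  then have "r' = r" using assms(6) by simp
  then have dec: "gram_decomposition N r A U \<sigma>" using dec by simp
  show ?thesis
    unfolding Let_def
  proof (intro conjI allI impI ballI)
    show "vec_space.rank N A = r" by (rule gram_decomposition_rank[OF A dec])
    show "\<exists>U \<sigma>. gram_decomposition N r A U \<sigma>" using dec by blast
    \<comment> \<open>From here on the decomposition is arbitrary, and no longer the one obtained
      above.\<close>
    fix U \<sigma> assume dec: "gram_decomposition N r A U \<sigma>"
    note basis = gram_decomposition_tensor_basis[OF assms(5) dec[unfolded A_def]]
    show "orthonormal_tensor_basis d I r
        (\<lambda>l i. \<Sum>n<N. X n i * (U $$ (n, l) * inverse (\<sigma> l))) (span (X ` {..<N}))"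
      by (rule basis(1))
    fix n i assume "n < N"
    then show "X n i = (\<Sum>l<r. (\<Sum>n<N. X n i * (U $$ (n, l) * inverse (\<sigma> l)))
        * U $$ (n, l) * \<sigma> l)"
      using basis(2)[of n i] by blast
  qed (fact sym psd)+
qed

end
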